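(* Let $n\ge 1$ and let $X$ be a random vector in $\mathbb{R}^n$ with a log-concave density $f$. Let $X^*$ be a random vector in $\mathbb{R}^n$ with density $f^*(x)=e^{-\sum_{i=1}^n x_i}$ restricted to the positive quadrant (that is, $f^*(x)=e^{-\sum_{i=1}^n x_i}$ if $x_i\ge 0$ for all $i$, and $f^*(x)=0$ otherwise). Then for every $\beta<1$, $$\mathbf{E}\Big[e^{\beta[\tilde h(X)-h(X)]}\Big]\leq \mathbf{E}\Big[e^{\beta[\tilde h(X^* )-h(X^* )]}\Big].$$
   Context: A function $f:\mathbb{R}^n\to[0,\infty)$ is log-concave if $f=e^{-U}$ for some convex function $U:\mathbb{R}^n\to(-\infty,+\infty]$; a log-concave density is a probability density function (with respect to Lebesgue measure) that is log-concave. For a random vector $Y$ in $\mathbb{R}^n$ with density $g$, the information content is the random variable $\tilde h(Y)=-\log g(Y)$, and the entropy is $h(Y)=\mathbf{E}[\tilde h(Y)]=-\int_{\mathbb{R}^n} g\log g$. Thus $\tilde h(X)=-\log f(X)$ and $\tilde h(X^* )=-\log f^*(X^* )$. *)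

theory Defs
  imports "HOL-Probability.Probability"
begin

text \<open>
  Convexity of an extended-valued function that never takes the value \<open>-\<infinity>\<close>.  Under this
  condition the right-hand side of the inequality is never of the form \<open>\<infinity> - \<infinity>\<close>, and the
  convention \<open>0 * \<infinity> = 0\<close> of \<^typ>\<open>ereal\<close> makes the endpoints \<open>t = 0\<close> and \<open>t = 1\<close> trivial.
\<close>
definition convex_ereal_fun :: "('v::real_vector \<Rightarrow> ereal) \<Rightarrow> bool" where
  "convex_ereal_fun U \<longleftrightarrow>
     (\<forall>x. U x \<noteq> -\<infinity>) \<and>
     (\<forall>x y. \<forall>t\<in>{0..1::real}.
        U ((1 - t) *\<^sub>R x + t *\<^sub>R y) \<le> ereal (1 - t) * U x + ereal t * U y)"

text \<open>\<open>f = exp (- U)\<close> for a convex \<open>U\<close> with values in \<open>(-\<infinity>, \<infinity>]\<close>, where \<open>exp (-\<infinity>) = 0\<close>.\<close>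
definition log_concave_fun :: "('v::real_vector \<Rightarrow> real) \<Rightarrow> bool" where
  "log_concave_fun f \<longleftrightarrow>
     (\<exists>U. convex_ereal_fun U \<and>
          (\<forall>x. f x = (if U x = \<infinity> then 0 else exp (- real_of_ereal (U x)))))"

text \<open>
  The information content of a point under the density \<open>g\<close>.  Where \<open>g\<close> vanishes, this has the
  value 0 because \<open>ln 0 = 0\<close>; a random vector with density \<open>g\<close> almost surely avoids these points.
\<close>
definition info_content :: "('v \<Rightarrow> real) \<Rightarrow> 'v \<Rightarrow> real" where
  "info_content g y = - ln (g y)"

text \<open>Entropy, in nats, of a random vector \<open>Y\<close> on \<open>M\<close> with density \<open>g\<close>.\<close>
definition info_entropy :: "'a measure \<Rightarrow> ('v \<Rightarrow> real) \<Rightarrow> ('a \<Rightarrow> 'v) \<Rightarrow> real" where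
  "info_entropy M g Y = prob_space.expectation M (\<lambda>\<omega>. info_content g (Y \<omega>))"

lemma info_entropy_eq_integral:
  fixes g :: "'v::euclidean_space \<Rightarrow> real"
  assumes "distributed M lborel Y g" and "\<And>x. 0 \<le> g x"
  shows "info_entropy M g Y = - (\<integral>x. g x * ln (g x) \<partial>lborel)"
proof -
  have [measurable]: "g \<in> borel_measurable borel"
    using distributed_real_measurable[OF _ assms(1)] assms(2) by simp
  have "(\<lambda>x. ln (g x)) \<in> borel_measurable lborel"
    by measurable
  from distributed_integral[OF assms(1) this assms(2)] show ?thesis
    by (simp add: info_entropy_def info_content_def)
qed

lemma info_entropy_eq_entropy:
  fixes g :: "'v::euclidean_space \<Rightarrow> real"
  assumes "prob_space M" and "distributed M lborel Y g" and "\<And>x. 0 \<le> g x"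
  shows "info_entropy M g Y = prob_space.entropy M (exp 1) lborel Y"
proof -
  interpret information_space M "exp 1"
    using assms(1) by (simp add: information_space_def information_space_axioms_def)
  show ?thesis
    using entropy_distr[OF assms(2,3)] info_entropy_eq_integral[OF assms(2,3)]
    by (simp add: log_def)
qed

definition quadrant_exp_density :: "real ^ 'n \<Rightarrow> real" where
  "quadrant_exp_density x = (if \<forall>i. 0 \<le> x $ i then exp (- (\<Sum>i\<in>UNIV. x $ i)) else 0)"

end

theory Submission
  imports Defs
begin

text \<open>
  The exponential moment of the information content of a density \<open>f\<close> on \<open>n\<close>-dimensional space is
  \<open>exp (- \<beta> h) * \<integral> f\<^sup>\<alpha>\<close> with \<open>\<alpha> = 1 - \<beta> > 0\<close>, so the theorem is an upper bound for \<open>\<integral> f\<^sup>\<alpha>\<close> in terms of the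
  entropy \<open>h = - \<integral> f ln f\<close>.  The source of the bound is that \<open>G \<alpha> = ln (\<alpha>\<^sup>n * \<integral> f\<^sup>\<alpha>)\<close> is concave in \<open>\<alpha>\<close> when \<open>f\<close> is
  log-concave (\<open>nn_integral_powr_log_concave\<close>).  Since \<open>G 1 = 0\<close> and \<open>G' 1 = n - h\<close>, concavity gives
  \<open>G \<alpha> \<le> (\<alpha> - 1) (n - h) = - \<beta> (n - h)\<close> (\<open>integral_powr_le_tangent\<close>), that is,
  \<open>exp (- \<beta> h) * \<integral> f\<^sup>\<alpha> \<le> exp (- \<beta> n) * (1 / \<alpha>)\<^sup>n\<close>.  For the product exponential density \<open>G\<close> vanishes identically
  and \<open>h = n\<close>, so the right-hand side is precisely its exponential moment.

  Concavity of \<open>G\<close> is an instance of the Prekopa--Leindler inequality.  If \<open>\<gamma> = (1 - l) \<alpha> + l \<alpha>'\<close>, then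
  \<open>(1 - l) \<alpha> / \<gamma>\<close> and \<open>l \<alpha>' / \<gamma>\<close> are convex weights, and the value of \<open>f\<^sup>\<gamma>\<close> at the corresponding combination
  of \<open>x\<close> and \<open>y\<close> is at least \<open>(f x powr \<alpha>) powr (1 - l) * (f y powr \<alpha>') powr l\<close>.  The weights of the points
  differ from the exponents \<open>1 - l\<close> and \<open>l\<close>; therefore the inequality is proved with arbitrary positive
  weights (\<open>prekopa_leindler\<close>), and the factor \<open>\<alpha>\<^sup>n\<close> in \<open>G\<close> comes from its constant.  On the line it follows
  from the Brunn--Minkowski inequality for level sets (\<open>brunn_minkowski_line\<close>), and in higher dimension by
  integrating out one coordinate at a time.

  Concavity also yields the finiteness of all \<open>\<integral> f\<^sup>\<alpha>\<close> (\<open>nn_integral_powr_finite\<close>), and with it the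
  integrability of \<open>f ln f\<close> and differentiation under the integral sign at \<open>\<alpha> = 1\<close>.
\<close>

section \<open>The Brunn--Minkowski inequality on the line\<close>

text \<open>
  If \<open>A\<close> has no largest element, an increasing sequence in \<open>A\<close> converges to the supremum of \<open>A\<close>
  (possibly infinite), and the corresponding initial pieces of \<open>A\<close> exhaust it.  Cutting at points
  of \<open>A\<close> itself is what the Brunn--Minkowski argument needs.
\<close>
lemma emeasure_Int_atMost_SUP:
  fixes A :: "real set"
  assumes [measurable]: "A \<in> sets borel" and ne: "A \<noteq> {}"
  shows "emeasure lborel A = (SUP a\<in>A. emeasure lborel (A \<inter> {..a}))"
proof (rule antisym)
  show "emeasure lborel A \<le> (SUP a\<in>A. emeasure lborel (A \<inter> {..a}))"
  proof (cases "\<exists>m\<in>A. \<forall>x\<in>A. x \<le> m")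
    case True
    then obtain m where m: "m \<in> A" "\<And>x. x \<in> A \<Longrightarrow> x \<le> m" by blast
    then have "A \<inter> {..m} = A" by auto
    then show ?thesis using m(1) by (metis SUP_upper)
  next
    case False
    obtain s :: "nat \<Rightarrow> ereal" where s: "incseq s" "range s \<subseteq> ereal ` A" "Sup (ereal ` A) = (SUP i. s i)"
      using Sup_countable_SUP[of "ereal ` A"] ne by auto
    then have "\<forall>i. \<exists>a\<in>A. s i = ereal a" by auto
    then obtain a where a: "\<And>i. a i \<in> A" "\<And>i. s i = ereal (a i)" by metis
    have inc: "incseq a" using s(1) by (simp add: incseq_def a(2))
    have un: "(\<Union>i. A \<inter> {..a i}) = A"
    proof (intro equalityI subsetI)
      fix x assume x: "x \<in> A"
      then obtain y where y: "y \<in> A" "x < y" using False by (meson not_le)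
      have "ereal x < ereal y" using y by simp
      also have "ereal y \<le> Sup (ereal ` A)" using y by (intro Sup_upper) auto
      finally have "\<exists>i. ereal x < s i" unfolding s(3) by (simp add: less_SUP_iff)
      then obtain i where "x < a i" by (auto simp: a(2))
      then show "x \<in> (\<Union>i. A \<inter> {..a i})" using x by (auto intro: less_imp_le)
    qed auto
    have "(SUP i. emeasure lborel (A \<inter> {..a i})) = emeasure lborel (\<Union>i. A \<inter> {..a i})"
      by (rule SUP_emeasure_incseq) (auto simp: incseq_def intro: order_trans[OF _ incseqD[OF inc]])
    then have "emeasure lborel A = (SUP i. emeasure lborel (A \<inter> {..a i}))" by (simp only: un)
    also have "\<dots> \<le> (SUP a\<in>A. emeasure lborel (A \<inter> {..a}))"
      using a(1) by (intro SUP_least SUP_upper)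
    finally show ?thesis .
  qed
qed (auto intro!: SUP_least emeasure_mono)

lemma emeasure_affine_vimage:
  fixes A :: "real set"
  assumes [measurable]: "A \<in> sets borel" and c: "c > 0"
  shows "emeasure lborel {z. (z - t) / c \<in> A} = ennreal c * emeasure lborel A"
proof -
  have "emeasure lborel {z. (z - t) / c \<in> A} = (\<integral>\<^sup>+z. indicator {z. (z - t) / c \<in> A} z \<partial>lborel)"
    by simp
  also have "\<dots> = (\<integral>\<^sup>+z. indicator A ((z - t) / c) \<partial>lborel)"
    by (simp add: indicator_def)
  also have "\<dots> = ennreal \<bar>c\<bar> * (\<integral>\<^sup>+z. indicator A ((t + c * z - t) / c) \<partial>lborel)"
    using c by (intro nn_integral_real_affine) auto
  also have "\<dots> = ennreal c * emeasure lborel A"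
    using c by simp
  finally show ?thesis .
qed

text \<open>
  The mirror image of the preceding fact under \<open>z \<mapsto> - z\<close>, which preserves Lebesgue measure.
\<close>
lemma emeasure_Int_atLeast_SUP:
  fixes A :: "real set"
  assumes [measurable]: "A \<in> sets borel" and ne: "A \<noteq> {}"
  shows "emeasure lborel A = (SUP a\<in>A. emeasure lborel (A \<inter> {a..}))"
proof -
  have refl: "emeasure lborel {z. - z \<in> B} = emeasure lborel B" if [measurable]: "B \<in> sets borel" for B :: "real set"
  proof -
    have "emeasure lborel {z. - z \<in> B} = (\<integral>\<^sup>+z. indicator {z. - z \<in> B} z \<partial>lborel)"
      by simp
    also have "\<dots> = (\<integral>\<^sup>+z. indicator B (- z) \<partial>lborel)"
      by (simp add: indicator_def)
    also have "\<dots> = (\<integral>\<^sup>+z. indicator B z \<partial>lborel)"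
      by (subst nn_integral_real_affine[where c = "-1" and t = 0]) auto
    finally show ?thesis by simp
  qed
  have "emeasure lborel A = emeasure lborel {z. - z \<in> A}" by (simp add: refl)
  also have "\<dots> = (SUP a\<in>{z. - z \<in> A}. emeasure lborel ({z. - z \<in> A} \<inter> {..a}))"
    using ne by (intro emeasure_Int_atMost_SUP) (auto, metis add.inverse_inverse)
  also have "\<dots> = (SUP a\<in>A. emeasure lborel (A \<inter> {a..}))"
  proof -
    have img: "A = uminus ` {z. - z \<in> A}" by (auto simp: image_iff) (metis add.inverse_inverse)
    have *: "emeasure lborel ({z. - z \<in> A} \<inter> {..a}) = emeasure lborel (A \<inter> {- a..})" for a
      using refl[of "A \<inter> {- a..}"] by (simp add: Int_def)
    show ?thesis unfolding * by (subst (3) img) (simp add: image_image)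
  qed
  finally show ?thesis .
qed

text \<open>
  For \<open>a \<in> A\<close> and \<open>b \<in> B\<close>, both \<open>u (A \<inter> (-\<infinity>, a]) + v b\<close> and \<open>u a + v (B \<inter> [b, \<infinity>))\<close> lie in \<open>C\<close>.
  The first lies to the left of \<open>u a + v b\<close> and the second to its right, so they share at most that
  point and their measures add up.  It remains to let \<open>a\<close> and \<open>b\<close> exhaust \<open>A\<close> and \<open>B\<close>.
\<close>
lemma brunn_minkowski_line:
  fixes A B C :: "real set"
  assumes [measurable]: "A \<in> sets borel" "B \<in> sets borel" "C \<in> sets borel"
    and ne: "A \<noteq> {}" "B \<noteq> {}" and u: "u > 0" and v: "v > 0"
    and sub: "\<And>x y. x \<in> A \<Longrightarrow> y \<in> B \<Longrightarrow> u * x + v * y \<in> C"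
  shows "ennreal u * emeasure lborel A + ennreal v * emeasure lborel B \<le> emeasure lborel C"
proof -
  have *: "ennreal u * emeasure lborel (A \<inter> {..a}) + ennreal v * emeasure lborel (B \<inter> {b..})
      \<le> emeasure lborel C" if ab: "a \<in> A" "b \<in> B" for a b
  proof -
    \<comment> \<open>The two pieces are written as preimages, so that they are visibly Borel.\<close>
    let ?P = "{z. (z - v * b) / u \<in> A \<inter> {..a}}"
    let ?Q = "{z. (z - u * a) / v \<in> B \<inter> {b..}}"
    let ?s = "{u * a + v * b}"
    have [measurable]: "?P \<in> sets borel" "?Q \<in> sets borel"
      by measurable
    have PQ: "?P \<inter> (?Q - ?s) = {}"
      using u v by (auto simp: field_simps)
    have PC: "?P \<subseteq> C"
    proof safe
      fix z assume "(z - v * b) / u \<in> A"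
      from sub[OF this ab(2)] show "z \<in> C" using u by simp
    qed
    have QC: "?Q \<subseteq> C"
    proof safe
      fix z assume "(z - u * a) / v \<in> B"
      from sub[OF ab(1) this] show "z \<in> C" using v by simp
    qed
    have "emeasure lborel (?Q - ?s) = emeasure lborel ?Q"
      by (rule emeasure_Diff_null_set) (auto simp: null_sets_def)
    then have "ennreal u * emeasure lborel (A \<inter> {..a}) + ennreal v * emeasure lborel (B \<inter> {b..})
        = emeasure lborel ?P + emeasure lborel (?Q - ?s)"
      using emeasure_affine_vimage[OF _ u, of "A \<inter> {..a}"] emeasure_affine_vimage[OF _ v, of "B \<inter> {b..}"]
      by simp
    also have "\<dots> = emeasure lborel (?P \<union> (?Q - ?s))"
      using PQ by (intro plus_emeasure) auto
    also have "\<dots> \<le> emeasure lborel C"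
      using PC QC by (intro emeasure_mono) auto
    finally show ?thesis .
  qed
  have "ennreal u * emeasure lborel A + ennreal v * emeasure lborel B
      = (SUP a\<in>A. SUP b\<in>B. ennreal u * emeasure lborel (A \<inter> {..a}) + ennreal v * emeasure lborel (B \<inter> {b..}))"
    unfolding emeasure_Int_atMost_SUP[OF assms(1) ne(1)] emeasure_Int_atLeast_SUP[OF assms(2) ne(2)]
      SUP_mult_left_ennreal ennreal_SUP_add_left[OF ne(1), symmetric] ennreal_SUP_add_right[OF ne(2)]
    by (rule SUP_commute)
  also have "\<dots> \<le> emeasure lborel C"
    using * by (intro SUP_least) auto
  finally show ?thesis .
qed

section \<open>The Prekopa--Leindler inequality\<close>

text \<open>
  This and the next lemma are the layer-cake formula \<open>\<integral> \<phi> = C * \<integral> |{\<phi> > t C}| dt\<close> over \<open>t > 0\<close>, with \<open>t\<close> cut off at 1: the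
  cut-off loses mass in general, and loses none when \<open>\<phi> \<le> C\<close>.  The two versions differ in the
  strictness of the level sets: the product of strict lower bounds for \<open>f\<close> and \<open>g\<close> will yield a
  non-strict lower bound for \<open>h\<close>.
\<close>
lemma nn_integral_ge_superlevel:
  fixes h :: "real \<Rightarrow> ennreal"
  assumes [measurable]: "h \<in> borel_measurable borel" and C: "C > 0"
  shows "ennreal C * (\<integral>\<^sup>+t. indicator {0<..<1} t * emeasure lborel {x. ennreal (t * C) \<le> h x} \<partial>lborel)
    \<le> (\<integral>\<^sup>+x. h x \<partial>lborel)"
proof -
  let ?I = "\<lambda>t x. indicator {0<..<1} t * indicator {x. ennreal (t * C) \<le> h x} x :: ennreal"
  have "(\<integral>\<^sup>+t. indicator {0<..<1} t * emeasure lborel {x. ennreal (t * C) \<le> h x} \<partial>lborel)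
      = (\<integral>\<^sup>+t. (\<integral>\<^sup>+x. ?I t x \<partial>lborel) \<partial>lborel)"
    by (simp add: nn_integral_cmult)
  also have "\<dots> = (\<integral>\<^sup>+x. (\<integral>\<^sup>+t. ?I t x \<partial>lborel) \<partial>lborel)"
    by (rule lborel_pair.Fubini') (simp add: indicator_def)
  finally have "ennreal C * (\<integral>\<^sup>+t. indicator {0<..<1} t * emeasure lborel {x. ennreal (t * C) \<le> h x} \<partial>lborel)
      = (\<integral>\<^sup>+x. ennreal C * (\<integral>\<^sup>+t. ?I t x \<partial>lborel) \<partial>lborel)"
    by (simp add: nn_integral_cmult indicator_def)
  also have "\<dots> \<le> (\<integral>\<^sup>+x. h x \<partial>lborel)"
  proof (rule nn_integral_mono)
    fix x :: real
    show "ennreal C * (\<integral>\<^sup>+t. ?I t x \<partial>lborel) \<le> h x"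
    proof (cases "h x")
      case (real r)
      have "(\<integral>\<^sup>+t. ?I t x \<partial>lborel) \<le> (\<integral>\<^sup>+t. indicator {0..r / C} t \<partial>lborel)"
        using C real by (intro nn_integral_mono) (auto simp: indicator_def field_simps ennreal_le_iff)
      also have "\<dots> = ennreal (r / C)" using C real by simp
      finally have "ennreal C * (\<integral>\<^sup>+t. ?I t x \<partial>lborel) \<le> ennreal C * ennreal (r / C)"
        by (intro mult_left_mono) auto
      also have "\<dots> = h x" using C real by (simp add: ennreal_mult[symmetric])
      finally show ?thesis .
    qed simp
  qed
  finally show ?thesis .
qed

lemma nn_integral_le_strict_superlevel:
  fixes f :: "real \<Rightarrow> ennreal"
  assumes [measurable]: "f \<in> borel_measurable borel" and A: "A > 0"
    and le: "\<And>x. f x \<le> ennreal A"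
  shows "(\<integral>\<^sup>+x. f x \<partial>lborel) \<le>
    ennreal A * (\<integral>\<^sup>+t. indicator {0<..<1} t * emeasure lborel {x. ennreal (t * A) < f x} \<partial>lborel)"
proof -
  let ?I = "\<lambda>t x. indicator {0<..<1} t * indicator {x. ennreal (t * A) < f x} x :: ennreal"
  have "(\<integral>\<^sup>+x. f x \<partial>lborel) \<le> (\<integral>\<^sup>+x. ennreal A * (\<integral>\<^sup>+t. ?I t x \<partial>lborel) \<partial>lborel)"
  proof (rule nn_integral_mono)
    fix x :: real
    obtain r where r: "f x = ennreal r" "0 \<le> r" "r \<le> A"
      using le[of x] A by (cases "f x") (auto simp: top_unique)
    have "f x = ennreal A * ennreal (r / A)" using A r by (simp add: ennreal_mult[symmetric])
    also have "ennreal (r / A) = (\<integral>\<^sup>+t. indicator {0<..<r / A} t \<partial>lborel)" using A r by simp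
    also have "\<dots> \<le> (\<integral>\<^sup>+t. ?I t x \<partial>lborel)"
    proof (rule nn_integral_mono)
      fix t :: real
      show "indicator {0<..<r / A} t \<le> ?I t x"
      proof (cases "t \<in> {0<..<r / A}")
        case True
        then have "t < r / A" "0 < t" by auto
        moreover have "r / A \<le> 1" using A r by simp
        moreover have "t * A < r" using \<open>t < r / A\<close> A by (simp add: field_simps)
        moreover have "t < 1" using \<open>t < r / A\<close> \<open>r / A \<le> 1\<close> by linarith
        ultimately show ?thesis using A r by (auto simp: indicator_def ennreal_less_iff)
      qed simp
    qed
    finally show "f x \<le> ennreal A * (\<integral>\<^sup>+t. ?I t x \<partial>lborel)"
      by (simp add: mult_left_mono)
  qed
  also have "\<dots> = ennreal A * (\<integral>\<^sup>+x. (\<integral>\<^sup>+t. ?I t x \<partial>lborel) \<partial>lborel)"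
    by (simp add: nn_integral_cmult indicator_def)
  also have "(\<integral>\<^sup>+x. (\<integral>\<^sup>+t. ?I t x \<partial>lborel) \<partial>lborel) = (\<integral>\<^sup>+t. (\<integral>\<^sup>+x. ?I t x \<partial>lborel) \<partial>lborel)"
    by (rule lborel_pair.Fubini') (simp add: indicator_def)
  also have "\<dots> = (\<integral>\<^sup>+t. indicator {0<..<1} t * emeasure lborel {x. ennreal (t * A) < f x} \<partial>lborel)"
    by (simp add: nn_integral_cmult)
  finally show ?thesis .
qed

text \<open>
  The inequality \<open>k * p powr (1 - l) * q powr l \<le> w\<close> for extended nonnegative \<open>p\<close> and \<open>q\<close>, with the
  convention \<open>0 * \<infinity> = 0\<close>.  Testing it on the positive reals below \<open>p\<close> and \<open>q\<close> avoids powers of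
  extended numbers.  Integrals of sections may be infinite, and in this form the conclusion of the
  one-dimensional inequality is literally the hypothesis for the next coordinate.
\<close>
definition geometric_mean_le :: "real \<Rightarrow> real \<Rightarrow> ennreal \<Rightarrow> ennreal \<Rightarrow> ennreal \<Rightarrow> bool" where
  "geometric_mean_le k l p q w \<longleftrightarrow>
     (\<forall>a b. 0 < a \<longrightarrow> 0 < b \<longrightarrow> ennreal a < p \<longrightarrow> ennreal b < q \<longrightarrow>
        ennreal (k * a powr (1 - l) * b powr l) \<le> w)"

lemma geometric_mean_le_ennrealD:
  assumes le: "geometric_mean_le k l (ennreal p) (ennreal q) (ennreal r)"
    and "0 < p" "0 < q" "0 \<le> r"
  shows "k * p powr (1 - l) * q powr l \<le> r"
proof (rule field_le_mult_one_interval)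
  fix s :: real assume s: "0 < s" "s < 1"
  have "ennreal (k * (s * p) powr (1 - l) * (s * q) powr l) \<le> ennreal r"
    using le s assms(2,3) unfolding geometric_mean_le_def
    by (auto simp: ennreal_less_iff)
  moreover have "(s * p) powr (1 - l) * (s * q) powr l = s * (p powr (1 - l) * q powr l)"
    using s assms by (simp add: powr_mult powr_add[symmetric] mult_ac)
  ultimately show "s * (k * p powr (1 - l) * q powr l) \<le> r"
    using \<open>0 \<le> r\<close> by (simp add: mult_ac)
qed

text \<open>
  Young's inequality when the weights \<open>u, v\<close> of the sum and the exponents \<open>1 - l, l\<close> are
  independent of each other; the mismatch is paid for by the constant.
\<close>
lemma mult_powr_le_weighted_sum:
  fixes u v l x y :: real
  assumes "0 < u" "0 < v" "0 < l" "l < 1" "0 < x" "0 < y"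
  shows "(u / (1 - l)) powr (1 - l) * (v / l) powr l * (x powr (1 - l) * y powr l) \<le> u * x + v * y"
proof -
  have "(u / (1 - l) * x) powr (1 - l) * (v / l * y) powr l
      \<le> (1 - l) * (u / (1 - l) * x) + l * (v / l * y)"
    using assms by (intro Youngs_inequality_0) auto
  also have "(u / (1 - l) * x) powr (1 - l) = (u / (1 - l)) powr (1 - l) * x powr (1 - l)"
    by (rule powr_mult)
  also have "(v / l * y) powr l = (v / l) powr l * y powr l"
    by (rule powr_mult)
  finally show ?thesis
    using assms by (simp add: mult_ac)
qed

text \<open>
  Let \<open>A\<close> and \<open>B\<close> be the suprema of \<open>f\<close> and \<open>g\<close>, and \<open>C = k * A powr (1 - l) * B powr l\<close>.  For \<open>0 < t < 1\<close> the
  level sets \<open>{f > t A}\<close> and \<open>{g > t B}\<close> are nonempty, and their combination with weights \<open>u\<close> and \<open>v\<close>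
  is contained in \<open>{h \<ge> t C}\<close>.  The Brunn--Minkowski inequality, integrated over \<open>t\<close>, gives
  \<open>C * (u * (\<integral>f) / A + v * (\<integral>g) / B) \<le> \<integral>h\<close>, and Young's inequality turns the sum into a product in
  which \<open>A\<close> and \<open>B\<close> cancel.  Normalising by the suprema makes both families of level sets nonempty
  for the same range of \<open>t\<close>.
  
  The weights \<open>u, v\<close> of the points are not tied to the exponents \<open>1 - l, l\<close>; the freedom to choose
  them is used to compare different powers of the same function.
\<close>
lemma prekopa_leindler_line_bounded:
  fixes f g h :: "real \<Rightarrow> ennreal"
  assumes [measurable]: "f \<in> borel_measurable borel" "g \<in> borel_measurable borel" "h \<in> borel_measurable borel"
    and u: "u > 0" and v: "v > 0" and l: "0 < l" "l < 1" and k: "k > 0"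
    and le: "\<And>x y. geometric_mean_le k l (f x) (g y) (h (u * x + v * y))"
    and bdd: "\<And>x. f x \<le> ennreal D" "\<And>x. g x \<le> ennreal D"
  shows "geometric_mean_le (k * ((u / (1 - l)) powr (1 - l) * (v / l) powr l)) l
    (\<integral>\<^sup>+x. f x \<partial>lborel) (\<integral>\<^sup>+x. g x \<partial>lborel) (\<integral>\<^sup>+x. h x \<partial>lborel)"
  unfolding geometric_mean_le_def
proof (intro allI impI)
  fix a b :: real
  assume a: "0 < a" "ennreal a < (\<integral>\<^sup>+x. f x \<partial>lborel)" and b: "0 < b" "ennreal b < (\<integral>\<^sup>+x. g x \<partial>lborel)"
  have sup: "\<exists>A>0. (\<forall>x. \<phi> x \<le> ennreal A) \<and> (\<forall>t<1. \<exists>x. ennreal (t * A) < \<phi> x)"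
    if pos: "0 < (\<integral>\<^sup>+x. \<phi> x \<partial>lborel)" and D: "\<And>x. \<phi> x \<le> ennreal D" for \<phi> :: "real \<Rightarrow> ennreal"
  proof -
    have "(SUP x. \<phi> x) \<le> ennreal D" using D by (intro SUP_least)
    then obtain A where A: "(SUP x. \<phi> x) = ennreal A" "0 \<le> A"
      by (cases "SUP x. \<phi> x") (auto simp: top_unique)
    have ub: "\<phi> x \<le> ennreal A" for x using A(1) by (metis SUP_upper UNIV_I)
    have "A \<noteq> 0"
    proof
      assume "A = 0"
      then have "\<phi> x = 0" for x using ub[of x] by simp
      then show False using pos by simp
    qed
    then have "0 < A" using A by simp
    moreover have "\<exists>x. ennreal (t * A) < \<phi> x" if "t < 1" for t
    proof -
      have "t * A < A" using that \<open>0 < A\<close> by simp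
      then have "ennreal (t * A) < (SUP x. \<phi> x)"
        unfolding A(1) using \<open>0 < A\<close> by (simp add: ennreal_less_iff ennreal_lessI)
      then show ?thesis by (simp add: less_SUP_iff)
    qed
    ultimately show ?thesis using ub by blast
  qed
  obtain A where A: "0 < A" "\<And>x. f x \<le> ennreal A" "\<And>t. t < 1 \<Longrightarrow> \<exists>x. ennreal (t * A) < f x"
    using sup[of f] a bdd by (metis gr_zeroI not_less_zero)
  obtain B where B: "0 < B" "\<And>x. g x \<le> ennreal B" "\<And>t. t < 1 \<Longrightarrow> \<exists>x. ennreal (t * B) < g x"
    using sup[of g] b bdd by (metis gr_zeroI not_less_zero)
  define C where "C = k * (A powr (1 - l) * B powr l)"
  have C: "C > 0" using A B k by (simp add: C_def)
  let ?F = "\<lambda>t. indicator {0<..<1} t * emeasure lborel {x. ennreal (t * A) < f x}"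
  let ?G = "\<lambda>t. indicator {0<..<1} t * emeasure lborel {x. ennreal (t * B) < g x}"
  let ?H = "\<lambda>t. indicator {0<..<1} t * emeasure lborel {x. ennreal (t * C) \<le> h x}"
  have level: "ennreal u * ?F t + ennreal v * ?G t \<le> ?H t" for t :: real
  proof (cases "t \<in> {0<..<1}")
    case True
    then have t: "0 < t" "t < 1" by auto
    have "ennreal u * emeasure lborel {x. ennreal (t * A) < f x} + ennreal v * emeasure lborel {x. ennreal (t * B) < g x}
        \<le> emeasure lborel {x. ennreal (t * C) \<le> h x}"
    proof (rule brunn_minkowski_line)
      fix x y assume "x \<in> {x. ennreal (t * A) < f x}" "y \<in> {x. ennreal (t * B) < g x}"
      then have "ennreal (k * (t * A) powr (1 - l) * (t * B) powr l) \<le> h (u * x + v * y)"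
        using le[of x y] t A B by (simp add: geometric_mean_le_def)
      moreover have "k * (t * A) powr (1 - l) * (t * B) powr l = t * C"
        using t A B by (simp add: C_def powr_mult powr_add[symmetric] mult_ac)
      ultimately show "u * x + v * y \<in> {x. ennreal (t * C) \<le> h x}" by simp
    qed (use A(3)[OF t(2)] B(3)[OF t(2)] u v in auto)
    then show ?thesis using True by simp
  qed simp
  have meas: "(\<lambda>t. indicator {0<..<1} t * emeasure lborel {x. ennreal (t * E) < \<phi> x}) \<in> borel_measurable lborel"
    if [measurable]: "\<phi> \<in> borel_measurable borel" for \<phi> :: "real \<Rightarrow> ennreal" and E :: real
  proof -
    have "(\<lambda>t. \<integral>\<^sup>+x. indicator {0<..<1} t * indicator {x. ennreal (t * E) < \<phi> x} x \<partial>lborel) \<in> borel_measurable lborel"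
      unfolding indicator_def by measurable
    then show ?thesis by (simp add: nn_integral_cmult)
  qed
  note [measurable] = meas[OF assms(1), of A] meas[OF assms(2), of B]
  have "u * (a / A) + v * (b / B) \<ge> (u / (1 - l)) powr (1 - l) * (v / l) powr l * ((a / A) powr (1 - l) * (b / B) powr l)"
    using u v l a b A B by (intro mult_powr_le_weighted_sum) auto
  then have "C * ((u / (1 - l)) powr (1 - l) * (v / l) powr l * ((a / A) powr (1 - l) * (b / B) powr l))
      \<le> C * (u * (a / A) + v * (b / B))" using C by (intro mult_left_mono) auto
  moreover have "C * ((a / A) powr (1 - l) * (b / B) powr l) = k * (a powr (1 - l) * b powr l)"
    using a b A B by (simp add: C_def powr_divide)
  moreover have "k * ((u / (1 - l)) powr (1 - l) * (v / l) powr l) * a powr (1 - l) * b powr l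
      = (u / (1 - l)) powr (1 - l) * (v / l) powr l * (k * (a powr (1 - l) * b powr l))"
    by (simp only: mult_ac)
  ultimately have "k * ((u / (1 - l)) powr (1 - l) * (v / l) powr l) * a powr (1 - l) * b powr l
      \<le> C * (u * (a / A) + v * (b / B))"
    by (metis mult.left_commute)
  then have "ennreal (k * ((u / (1 - l)) powr (1 - l) * (v / l) powr l) * a powr (1 - l) * b powr l)
      \<le> ennreal C * (ennreal u * ennreal (a / A) + ennreal v * ennreal (b / B))"
    using u v a b A B C
    by (subst (asm) ennreal_le_iff[symmetric]) (simp_all add: ennreal_mult[symmetric] ennreal_plus[symmetric] del: ennreal_plus)
  also have "\<dots> \<le> ennreal C * (ennreal u * (\<integral>\<^sup>+t. ?F t \<partial>lborel) + ennreal v * (\<integral>\<^sup>+t. ?G t \<partial>lborel))"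
  proof -
    have div: "ennreal (c / E) \<le> J" if "0 < E" "0 < c" "ennreal c \<le> ennreal E * J" for c E :: real and J
    proof -
      have "ennreal (c / E) = ennreal (1 / E) * ennreal c" using that by (simp add: ennreal_mult[symmetric])
      also have "\<dots> \<le> ennreal (1 / E) * (ennreal E * J)" using that by (intro mult_left_mono) auto
      also have "\<dots> = J" using that by (simp add: mult.assoc[symmetric] ennreal_mult[symmetric])
      finally show ?thesis .
    qed
    have "ennreal a \<le> ennreal A * (\<integral>\<^sup>+t. ?F t \<partial>lborel)"
      using a(2) nn_integral_le_strict_superlevel[OF _ A(1,2)] by (meson assms(1) order.trans less_imp_le)
    moreover have "ennreal b \<le> ennreal B * (\<integral>\<^sup>+t. ?G t \<partial>lborel)"
      using b(2) nn_integral_le_strict_superlevel[OF _ B(1,2)] by (meson assms(2) order.trans less_imp_le)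
    ultimately show ?thesis
      using a(1) b(1) A(1) B(1) by (intro mult_left_mono add_mono div) auto
  qed
  also have "\<dots> = ennreal C * (\<integral>\<^sup>+t. ennreal u * ?F t + ennreal v * ?G t \<partial>lborel)"
    by (subst nn_integral_add) (simp_all add: nn_integral_cmult)
  also have "\<dots> \<le> ennreal C * (\<integral>\<^sup>+t. ?H t \<partial>lborel)"
    by (intro mult_left_mono nn_integral_mono level) auto
  also have "\<dots> \<le> (\<integral>\<^sup>+x. h x \<partial>lborel)"
    using C by (intro nn_integral_ge_superlevel) auto
  finally show "ennreal (k * ((u / (1 - l)) powr (1 - l) * (v / l) powr l) * a powr (1 - l) * b powr l)
      \<le> (\<integral>\<^sup>+x. h x \<partial>lborel)" .
qed

text \<open>
  Monotone convergence, stated for all large truncation levels so that a common level can serve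
  two functions.
\<close>
lemma less_nn_integral_imp_less_truncated:
  fixes f :: "'a \<Rightarrow> ennreal"
  assumes [measurable]: "f \<in> borel_measurable M" and a: "a < (\<integral>\<^sup>+x. f x \<partial>M)"
  shows "\<exists>m. \<forall>n\<ge>m. a < (\<integral>\<^sup>+x. min (f x) (of_nat n) \<partial>M)"
proof -
  have sup: "(SUP n. min (f x) (of_nat n :: ennreal)) = f x" for x
  proof -
    have "(SUP n. inf (f x) (of_nat n :: ennreal)) = inf (f x) (SUP n. of_nat n)"
      by (rule inf_SUP[symmetric])
    then show ?thesis by (simp add: ennreal_SUP_of_nat_eq_top inf_min)
  qed
  have inc: "incseq (\<lambda>n x. min (f x) (of_nat n))"
    by (auto simp: incseq_def le_fun_def min_le_iff_disj)
  have "a < (\<integral>\<^sup>+x. (SUP n. min (f x) (of_nat n)) \<partial>M)" using a by (simp only: sup)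
  also have "\<dots> = (SUP n. \<integral>\<^sup>+x. min (f x) (of_nat n) \<partial>M)"
    by (rule nn_integral_monotone_convergence_SUP[OF inc]) measurable
  finally obtain m where m: "a < (\<integral>\<^sup>+x. min (f x) (of_nat m) \<partial>M)" by (auto simp: less_SUP_iff)
  have "a < (\<integral>\<^sup>+x. min (f x) (of_nat n) \<partial>M)" if "n \<ge> m" for n
    using m by (rule less_le_trans) (use that in \<open>auto intro!: nn_integral_mono min.mono\<close>)
  then show ?thesis by blast
qed

lemma prekopa_leindler_line:
  fixes f g h :: "real \<Rightarrow> ennreal"
  assumes [measurable]: "f \<in> borel_measurable borel" "g \<in> borel_measurable borel" "h \<in> borel_measurable borel"
    and u: "u > 0" and v: "v > 0" and l: "0 < l" "l < 1" and k: "k > 0"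
    and le: "\<And>x y. geometric_mean_le k l (f x) (g y) (h (u * x + v * y))"
  shows "geometric_mean_le (k * ((u / (1 - l)) powr (1 - l) * (v / l) powr l)) l
    (\<integral>\<^sup>+x. f x \<partial>lborel) (\<integral>\<^sup>+x. g x \<partial>lborel) (\<integral>\<^sup>+x. h x \<partial>lborel)"
  unfolding geometric_mean_le_def
proof (intro allI impI)
  fix a b :: real
  assume a: "0 < a" "ennreal a < (\<integral>\<^sup>+x. f x \<partial>lborel)" and b: "0 < b" "ennreal b < (\<integral>\<^sup>+x. g x \<partial>lborel)"
  obtain m1 where m1: "\<And>n. n \<ge> m1 \<Longrightarrow> ennreal a < (\<integral>\<^sup>+x. min (f x) (of_nat n) \<partial>lborel)"
    using less_nn_integral_imp_less_truncated[OF _ a(2)] by auto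
  obtain m2 where m2: "\<And>n. n \<ge> m2 \<Longrightarrow> ennreal b < (\<integral>\<^sup>+x. min (g x) (of_nat n) \<partial>lborel)"
    using less_nn_integral_imp_less_truncated[OF _ b(2)] by auto
  define n where "n = max m1 m2"
  have "geometric_mean_le (k * ((u / (1 - l)) powr (1 - l) * (v / l) powr l)) l
    (\<integral>\<^sup>+x. min (f x) (of_nat n) \<partial>lborel) (\<integral>\<^sup>+x. min (g x) (of_nat n) \<partial>lborel) (\<integral>\<^sup>+x. h x \<partial>lborel)"
    using u v l k le
    by (intro prekopa_leindler_line_bounded[where D = "real n"])
       (auto simp: geometric_mean_le_def ennreal_of_nat_eq_real_of_nat)
  then show "ennreal (k * ((u / (1 - l)) powr (1 - l) * (v / l) powr l) * a powr (1 - l) * b powr l)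
      \<le> (\<integral>\<^sup>+x. h x \<partial>lborel)"
    using a(1) b(1) m1[of n] m2[of n] by (auto simp: geometric_mean_le_def n_def)
qed

text \<open>
  Induction on the coordinates.  For fixed remaining coordinates the one-dimensional inequality
  applies to the sections and shows that the partial integrals satisfy the hypothesis again, with
  a constant that has gained one factor.  The constant \<open>k\<close> is therefore generalised in the
  induction.
\<close>
lemma prekopa_leindler_PiM:
  fixes f g h :: "('i \<Rightarrow> real) \<Rightarrow> ennreal"
  assumes "finite I"
    and "f \<in> borel_measurable (Pi\<^sub>M I (\<lambda>_. lborel))" "g \<in> borel_measurable (Pi\<^sub>M I (\<lambda>_. lborel))"
      "h \<in> borel_measurable (Pi\<^sub>M I (\<lambda>_. lborel))"
    and u: "u > 0" and v: "v > 0" and l: "0 < l" "l < 1"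
    and "\<And>x y. x \<in> space (Pi\<^sub>M I (\<lambda>_. lborel)) \<Longrightarrow> y \<in> space (Pi\<^sub>M I (\<lambda>_. lborel)) \<Longrightarrow>
      geometric_mean_le 1 l (f x) (g y) (h (\<lambda>i\<in>I. u * x i + v * y i))"
  shows "geometric_mean_le (((u / (1 - l)) powr (1 - l) * (v / l) powr l) ^ card I) l
    (\<integral>\<^sup>+x. f x \<partial>(Pi\<^sub>M I (\<lambda>_. lborel))) (\<integral>\<^sup>+x. g x \<partial>(Pi\<^sub>M I (\<lambda>_. lborel)))
    (\<integral>\<^sup>+x. h x \<partial>(Pi\<^sub>M I (\<lambda>_. lborel)))"
proof -
  let ?K = "(u / (1 - l)) powr (1 - l) * (v / l) powr l"
  let ?L = "\<lambda>_::'i. lborel :: real measure"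
  interpret product_sigma_finite ?L by standard
  have K: "?K > 0" using u v l by simp
  have "geometric_mean_le (k * ?K ^ card I) l (\<integral>\<^sup>+x. f x \<partial>(Pi\<^sub>M I ?L)) (\<integral>\<^sup>+x. g x \<partial>(Pi\<^sub>M I ?L)) (\<integral>\<^sup>+x. h x \<partial>(Pi\<^sub>M I ?L))"
    if "k > 0" and "f \<in> borel_measurable (Pi\<^sub>M I ?L)" "g \<in> borel_measurable (Pi\<^sub>M I ?L)" "h \<in> borel_measurable (Pi\<^sub>M I ?L)"
      and "\<And>x y. x \<in> space (Pi\<^sub>M I ?L) \<Longrightarrow> y \<in> space (Pi\<^sub>M I ?L) \<Longrightarrow>
        geometric_mean_le k l (f x) (g y) (h (\<lambda>i\<in>I. u * x i + v * y i))" for k f g h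
    using \<open>finite I\<close> that
  proof (induction I arbitrary: k f g h)
    case empty
    show ?case
      using empty(5)[of "\<lambda>_. undefined" "\<lambda>_. undefined"]
      by (simp add: nn_integral_empty space_PiM restrict_def)
  next
    case (insert i I)
    note [measurable] = insert.prems(2-4)
    have "geometric_mean_le ((k * ?K) * ?K ^ card I) l
        (\<integral>\<^sup>+x. \<integral>\<^sup>+s. f (x(i := s)) \<partial>lborel \<partial>(Pi\<^sub>M I ?L)) (\<integral>\<^sup>+x. \<integral>\<^sup>+s. g (x(i := s)) \<partial>lborel \<partial>(Pi\<^sub>M I ?L))
        (\<integral>\<^sup>+x. \<integral>\<^sup>+s. h (x(i := s)) \<partial>lborel \<partial>(Pi\<^sub>M I ?L))"
    proof (rule insert.IH)
      show "0 < k * ?K" using insert.prems(1) K by simp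
    next
      fix x y assume xy: "x \<in> space (Pi\<^sub>M I ?L)" "y \<in> space (Pi\<^sub>M I ?L)"
      let ?z = "\<lambda>i\<in>I. u * x i + v * y i"
      have z: "?z \<in> space (Pi\<^sub>M I ?L)" by (simp add: space_PiM)
      have upd [measurable]: "(\<lambda>s. w(i := s)) \<in> borel \<rightarrow>\<^sub>M Pi\<^sub>M (insert i I) ?L" if "w \<in> space (Pi\<^sub>M I ?L)" for w
        using measurable_component_update[of w I ?L i] that insert.hyps(2) by simp
      show "geometric_mean_le (k * ?K) l (\<integral>\<^sup>+s. f (x(i := s)) \<partial>lborel) (\<integral>\<^sup>+s. g (y(i := s)) \<partial>lborel)
          (\<integral>\<^sup>+s. h (?z(i := s)) \<partial>lborel)"
      proof (rule prekopa_leindler_line[OF _ _ _ u v l insert.prems(1)])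
        show "(\<lambda>s. f (x(i := s))) \<in> borel_measurable borel" "(\<lambda>s. g (y(i := s))) \<in> borel_measurable borel"
          "(\<lambda>s. h (?z(i := s))) \<in> borel_measurable borel"
          using measurable_compose[OF upd[OF xy(1)] insert.prems(2)] measurable_compose[OF upd[OF xy(2)] insert.prems(3)]
            measurable_compose[OF upd[OF z] insert.prems(4)] by (simp_all add: fun_upd_def)
        fix s t
        have "(\<lambda>j\<in>insert i I. u * (x(i := s)) j + v * (y(i := t)) j) = ?z(i := u * s + v * t)"
          using insert.hyps(2) by (auto simp: fun_eq_iff restrict_def)
        moreover have "x(i := s) \<in> space (Pi\<^sub>M (insert i I) ?L)" "y(i := t) \<in> space (Pi\<^sub>M (insert i I) ?L)"
          using xy by (auto simp: space_PiM PiE_def extensional_def)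
        ultimately show "geometric_mean_le k l (f (x(i := s))) (g (y(i := t))) (h (?z(i := u * s + v * t)))"
          using insert.prems(5) by metis
      qed
    qed measurable
    then show ?case
      using insert.hyps by (simp add: product_nn_integral_insert mult_ac)
  qed
  from this[of 1 f g h] show ?thesis using assms by simp
qed

text \<open>
  Lebesgue measure on a Euclidean space is the image of a product measure under a map that is
  linear, hence compatible with the combinations \<open>u x + v y\<close>.
\<close>
lemma prekopa_leindler:
  fixes f g h :: "'v::euclidean_space \<Rightarrow> ennreal"
  assumes [measurable]: "f \<in> borel_measurable borel" "g \<in> borel_measurable borel" "h \<in> borel_measurable borel"
    and u: "u > 0" and v: "v > 0" and l: "0 < l" "l < 1"
    and le: "\<And>x y. geometric_mean_le 1 l (f x) (g y) (h (u *\<^sub>R x + v *\<^sub>R y))"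
  shows "geometric_mean_le (((u / (1 - l)) powr (1 - l) * (v / l) powr l) ^ DIM('v)) l
    (\<integral>\<^sup>+x. f x \<partial>lborel) (\<integral>\<^sup>+x. g x \<partial>lborel) (\<integral>\<^sup>+x. h x \<partial>lborel)"
proof -
  let ?T = "\<lambda>x. \<Sum>b\<in>Basis. x b *\<^sub>R b :: 'v"
  let ?P = "Pi\<^sub>M Basis (\<lambda>_::'v. lborel :: real measure)"
  have [measurable]: "?T \<in> ?P \<rightarrow>\<^sub>M borel" by measurable
  have T: "?T (\<lambda>b\<in>Basis. u * x b + v * y b) = u *\<^sub>R ?T x + v *\<^sub>R ?T y" for x y
    by (simp add: scaleR_sum_right sum.distrib[symmetric] scaleR_add_left)
  have "geometric_mean_le (((u / (1 - l)) powr (1 - l) * (v / l) powr l) ^ card (Basis :: 'v set)) l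
      (\<integral>\<^sup>+x. f (?T x) \<partial>?P) (\<integral>\<^sup>+x. g (?T x) \<partial>?P) (\<integral>\<^sup>+x. h (?T x) \<partial>?P)"
    using u v l by (intro prekopa_leindler_PiM) (simp_all only: T le finite_Basis, measurable)
  then show ?thesis
    by (subst (1 2 3) lborel_eq) (simp add: nn_integral_distr)
qed

section \<open>Power integrals of a log-concave density\<close>

lemma log_concave_fun_nonneg: "log_concave_fun f \<Longrightarrow> 0 \<le> f x"
  unfolding log_concave_fun_def by (metis exp_ge_zero order_refl)

text \<open>
  The exponential turns the convexity inequality for the potential \<open>U\<close> into a geometric mean; where
  \<open>f\<close> is positive, \<open>U\<close> is finite.
\<close>
lemma log_concave_funD:
  assumes "log_concave_fun f" and u: "0 \<le> u" "0 \<le> v" "u + v = 1" and pos: "0 < f x" "0 < f y"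
  shows "f x powr u * f y powr v \<le> f (u *\<^sub>R x + v *\<^sub>R y)"
proof -
  obtain U where cv: "convex_ereal_fun U"
    and f: "\<And>x. f x = (if U x = \<infinity> then 0 else exp (- real_of_ereal (U x)))"
    using assms(1) by (auto simp: log_concave_fun_def)
  have nm: "\<And>x. U x \<noteq> -\<infinity>" using cv by (auto simp: convex_ereal_fun_def)
  obtain p where p: "U x = ereal p" using pos(1) nm[of x] by (cases "U x") (auto simp: f)
  obtain q where q: "U y = ereal q" using pos(2) nm[of y] by (cases "U y") (auto simp: f)
  have uv: "u = 1 - v" "v \<in> {0..1}" using u by auto
  have "U (u *\<^sub>R x + v *\<^sub>R y) \<le> ereal u * U x + ereal v * U y"
    using cv uv(2) unfolding convex_ereal_fun_def uv(1) by blast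
  then have le: "U (u *\<^sub>R x + v *\<^sub>R y) \<le> ereal (u * p + v * q)" by (simp add: p q)
  then obtain r where r: "U (u *\<^sub>R x + v *\<^sub>R y) = ereal r"
    using nm[of "u *\<^sub>R x + v *\<^sub>R y"] by (cases "U (u *\<^sub>R x + v *\<^sub>R y)") auto
  have "f x powr u * f y powr v = exp (- (u * p + v * q))"
    by (simp add: f p q powr_def exp_add[symmetric])
  also have "\<dots> \<le> f (u *\<^sub>R x + v *\<^sub>R y)" using le by (simp add: f r)
  finally show ?thesis .
qed

text \<open>
  The function \<open>\<alpha> \<mapsto> \<alpha>\<^sup>n * \<integral> f\<^sup>\<alpha>\<close>, where \<open>n\<close> is the dimension, is log-concave on \<open>(0, \<infinity>)\<close>: multiplying the
  conclusion by \<open>\<gamma>\<^sup>n\<close> gives the usual form.  The weights \<open>u = (1 - l) \<alpha> / \<gamma>\<close> and \<open>v = l \<alpha>' / \<gamma>\<close> sum to 1, and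
  log-concavity of \<open>f\<close> with these weights, raised to the power \<open>\<gamma>\<close>, is exactly the hypothesis of the
  Prekopa--Leindler inequality for \<open>f\<^sup>\<alpha>\<close>, \<open>f powr \<alpha>'\<close> and \<open>f\<^sup>\<gamma>\<close>.
\<close>
lemma nn_integral_powr_log_concave:
  fixes f :: "'v::euclidean_space \<Rightarrow> real"
  assumes lc: "log_concave_fun f" and [measurable]: "f \<in> borel_measurable borel"
    and \<alpha>: "0 < \<alpha>" "0 < \<alpha>'" and l: "0 < l" "l < 1" and \<gamma>: "\<gamma> = (1 - l) * \<alpha> + l * \<alpha>'"
  shows "geometric_mean_le (((\<alpha> / \<gamma>) powr (1 - l) * (\<alpha>' / \<gamma>) powr l) ^ DIM('v)) l
    (\<integral>\<^sup>+x. ennreal (f x powr \<alpha>) \<partial>lborel) (\<integral>\<^sup>+x. ennreal (f x powr \<alpha>') \<partial>lborel)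
    (\<integral>\<^sup>+x. ennreal (f x powr \<gamma>) \<partial>lborel)"
proof -
  have \<gamma>0: "0 < \<gamma>" using \<alpha> l by (auto simp: \<gamma> intro!: add_pos_pos)
  define u where "u = (1 - l) * \<alpha> / \<gamma>"
  define v where "v = l * \<alpha>' / \<gamma>"
  have uv: "0 < u" "0 < v" using \<alpha> l \<gamma>0 by (auto simp: u_def v_def)
  have uv1: "u + v = 1" using \<gamma>0 by (simp add: u_def v_def add_divide_distrib[symmetric] \<gamma>[symmetric])
  have "geometric_mean_le (((u / (1 - l)) powr (1 - l) * (v / l) powr l) ^ DIM('v)) l
    (\<integral>\<^sup>+x. ennreal (f x powr \<alpha>) \<partial>lborel) (\<integral>\<^sup>+x. ennreal (f x powr \<alpha>') \<partial>lborel)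
    (\<integral>\<^sup>+x. ennreal (f x powr \<gamma>) \<partial>lborel)"
  proof (rule prekopa_leindler[OF _ _ _ uv l])
    fix x y :: 'v
    show "geometric_mean_le 1 l (ennreal (f x powr \<alpha>)) (ennreal (f y powr \<alpha>'))
      (ennreal (f (u *\<^sub>R x + v *\<^sub>R y) powr \<gamma>))"
      unfolding geometric_mean_le_def
    proof (intro allI impI)
      fix a b :: real
      assume a: "0 < a" "ennreal a < ennreal (f x powr \<alpha>)" and b: "0 < b" "ennreal b < ennreal (f y powr \<alpha>')"
      have a': "a < f x powr \<alpha>" and b': "b < f y powr \<alpha>'"
        using a b by (auto simp: ennreal_less_iff)
      have "f x \<noteq> 0" "f y \<noteq> 0" using a(1) b(1) a' b' by auto
      then have pos: "0 < f x" "0 < f y"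
        using log_concave_fun_nonneg[OF lc] by (auto simp: less_le)
      have "a powr (1 - l) * b powr l \<le> (f x powr \<alpha>) powr (1 - l) * (f y powr \<alpha>') powr l"
        using a' b' a(1) b(1) l by (intro mult_mono powr_mono2) auto
      also have "\<dots> = (f x powr u * f y powr v) powr \<gamma>"
        using \<gamma>0 pos by (simp add: powr_powr powr_mult u_def v_def mult_ac)
      also have "\<dots> \<le> f (u *\<^sub>R x + v *\<^sub>R y) powr \<gamma>"
        using log_concave_funD[OF lc _ _ uv1 pos] uv \<gamma>0 pos by (intro powr_mono2) auto
      finally show "ennreal (1 * a powr (1 - l) * b powr l) \<le> ennreal (f (u *\<^sub>R x + v *\<^sub>R y) powr \<gamma>)"
        by (simp add: ennreal_leI)
    qed
  qed measurable
  moreover have "u / (1 - l) = \<alpha> / \<gamma>" "v / l = \<alpha>' / \<gamma>" using l by (auto simp: u_def v_def)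
  ultimately show ?thesis by simp
qed

lemma nn_integral_powr_pos:
  fixes f :: "'v::euclidean_space \<Rightarrow> real"
  assumes [measurable]: "f \<in> borel_measurable borel" and nn: "\<And>x. 0 \<le> f x"
    and one: "(\<integral>\<^sup>+x. ennreal (f x) \<partial>lborel) = 1"
  shows "0 < (\<integral>\<^sup>+x. ennreal (f x powr \<alpha>) \<partial>lborel)"
proof (rule ccontr)
  assume "\<not> ?thesis"
  then have "(\<integral>\<^sup>+x. ennreal (f x powr \<alpha>) \<partial>lborel) = 0" by (simp add: not_less)
  then have "AE x in lborel. ennreal (f x powr \<alpha>) = 0" by (subst (asm) nn_integral_0_iff_AE) auto
  then have "AE x in lborel. ennreal (f x) = 0"
    by eventually_elim (auto simp: ennreal_eq_0_iff)
  then have "(\<integral>\<^sup>+x. ennreal (f x) \<partial>lborel) = 0" by (subst nn_integral_0_iff_AE) auto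
  with one show False by simp
qed

text \<open>
  A concave function that is finite at an interior point and nowhere \<open>-\<infinity>\<close> cannot take the value
  \<open>+\<infinity>\<close>.  Here the interior point is \<open>1\<close>, where the integral is 1, placed between \<open>\<alpha>\<close> and an exponent
  \<open>\<alpha>'\<close> on its other side.
\<close>
lemma nn_integral_powr_finite:
  fixes f :: "'v::euclidean_space \<Rightarrow> real"
  assumes lc: "log_concave_fun f" and [measurable]: "f \<in> borel_measurable borel"
    and one: "(\<integral>\<^sup>+x. ennreal (f x) \<partial>lborel) = 1" and \<alpha>: "0 < \<alpha>"
  shows "(\<integral>\<^sup>+x. ennreal (f x powr \<alpha>) \<partial>lborel) < \<infinity>"
proof (cases "\<alpha> = 1")
  case True
  then show ?thesis using one log_concave_fun_nonneg[OF lc] by simp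
next
  case False
  define \<alpha>' :: real where "\<alpha>' = (if \<alpha> < 1 then 2 else 1/2)"
  define l where "l = (1 - \<alpha>) / (\<alpha>' - \<alpha>)"
  have l: "0 < l" "l < 1" and \<alpha>': "0 < \<alpha>'"
    using False \<alpha> by (auto simp: l_def \<alpha>'_def field_simps)
  have "\<alpha>' \<noteq> \<alpha>" using False by (auto simp: \<alpha>'_def)
  then have "l * (\<alpha>' - \<alpha>) = 1 - \<alpha>" by (simp add: l_def)
  then have comb: "1 = (1 - l) * \<alpha> + l * \<alpha>'" by (simp add: algebra_simps)
  define K where "K = ((\<alpha> / 1) powr (1 - l) * (\<alpha>' / 1) powr l) ^ DIM('v)"
  have K: "0 < K" using \<alpha> \<alpha>' by (simp add: K_def)
  have le: "geometric_mean_le K l (\<integral>\<^sup>+x. ennreal (f x powr \<alpha>) \<partial>lborel)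
      (\<integral>\<^sup>+x. ennreal (f x powr \<alpha>') \<partial>lborel) 1"
    using nn_integral_powr_log_concave[OF lc assms(2) \<alpha> \<alpha>' l comb] one log_concave_fun_nonneg[OF lc]
    by (simp add: K_def)
  obtain b' where b': "0 < b'" "b' < (\<integral>\<^sup>+x. ennreal (f x powr \<alpha>') \<partial>lborel)"
    using nn_integral_powr_pos[OF assms(2) log_concave_fun_nonneg[OF lc] one] dense by blast
  define b where "b = enn2real b'"
  have "b' < \<infinity>" using less_le_trans[OF b'(2) top_greatest] by simp
  then have b: "0 < b" "ennreal b < (\<integral>\<^sup>+x. ennreal (f x powr \<alpha>') \<partial>lborel)"
    using b' by (auto simp: b_def enn2real_positive_iff)
  \<comment> \<open>If the integral were infinite, every \<open>a\<close> would be admissible; this one makes the lower bound equal to 2 > 1.\<close>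
  define a where "a = (2 / (K * b powr l)) powr (1 / (1 - l))"
  have a: "0 < a" "a powr (1 - l) = 2 / (K * b powr l)"
    using K b l by (auto simp: a_def powr_powr)
  show ?thesis
  proof (rule ccontr)
    assume "\<not> ?thesis"
    then have "(\<integral>\<^sup>+x. ennreal (f x powr \<alpha>) \<partial>lborel) = \<infinity>" by (simp add: not_less top_unique)
    then have "ennreal (K * a powr (1 - l) * b powr l) \<le> 1"
      using le a(1) b by (auto simp: geometric_mean_le_def)
    moreover have "K * a powr (1 - l) * b powr l = 2"
      using K b by (simp add: a(2))
    ultimately show False by (simp add: ennreal_le_1)
  qed
qed

lemma integrable_powr:
  fixes f :: "'v::euclidean_space \<Rightarrow> real"
  assumes "log_concave_fun f" and [measurable]: "f \<in> borel_measurable borel"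
    and "(\<integral>\<^sup>+x. ennreal (f x) \<partial>lborel) = 1" and "0 < \<alpha>"
  shows "integrable lborel (\<lambda>x. f x powr \<alpha>)"
  using nn_integral_powr_finite[OF assms] by (intro integrableI_nonneg) auto

text \<open>
  The logarithm is dominated by small positive and negative powers, so that \<open>f ln f\<close> is integrable
  as soon as two powers of \<open>f\<close> with exponents on either side of 1 are.
\<close>
lemma abs_mult_ln_le:
  fixes y :: real
  assumes "0 \<le> y"
  shows "\<bar>y * ln y\<bar> \<le> 2 * (y powr (3/2) + y powr (1/2))"
proof (cases "y = 0")
  case False
  then have y: "0 < y" using assms by simp
  have "\<bar>ln y / 2\<bar> \<le> exp (ln y / 2) + exp (- (ln y / 2))"
    using exp_ge_add_one_self[of "ln y / 2"] exp_ge_add_one_self[of "- (ln y / 2)"]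
      exp_gt_zero[of "ln y / 2"] exp_gt_zero[of "- (ln y / 2)"]
    by linarith
  then have "y * \<bar>ln y / 2\<bar> \<le> y * (exp (ln y / 2) + exp (- (ln y / 2)))"
    using y by (intro mult_left_mono) auto
  moreover have "exp z * exp (z / 2) = exp z powr (3/2)" "exp z * exp (- (z / 2)) = exp z powr (1/2)" for z :: real
    by (simp_all add: powr_def exp_add[symmetric])
  from this[of "ln y"] have "y * exp (ln y / 2) = y powr (3/2)" "y * exp (- (ln y / 2)) = y powr (1/2)"
    using y by simp_all
  ultimately show ?thesis using y by (simp add: abs_mult algebra_simps)
qed simp

lemma integrable_mult_ln:
  fixes f :: "'v::euclidean_space \<Rightarrow> real"
  assumes lc: "log_concave_fun f" and m [measurable]: "f \<in> borel_measurable borel"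
    and one: "(\<integral>\<^sup>+x. ennreal (f x) \<partial>lborel) = 1"
  shows "integrable lborel (\<lambda>x. f x * ln (f x))"
proof (rule Bochner_Integration.integrable_bound)
  show "integrable lborel (\<lambda>x. 2 * (f x powr (3/2) + f x powr (1/2)))"
    using integrable_powr[OF lc m one, of "3/2"] integrable_powr[OF lc m one, of "1/2"] by auto
  show "AE x in lborel. norm (f x * ln (f x)) \<le> norm (2 * (f x powr (3/2) + f x powr (1/2)))"
    using abs_mult_ln_le[OF log_concave_fun_nonneg[OF lc]] by (auto intro!: AE_I2 order_trans[OF _ abs_ge_self])
qed measurable

text \<open>
  The derivative of \<open>t \<mapsto> y powr (1 + t * d)\<close> at 0, taken along a sequence in \<open>(0, 1)\<close>.
\<close>
lemma powr_difference_quotient_tendsto: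
  fixes y d :: real
  assumes "0 \<le> y"
  shows "(\<lambda>k. (y powr (1 + (1 / real (k + 2)) * d) - y) / (1 / real (k + 2))) \<longlonglongrightarrow> d * (y * ln y)"
proof (cases "y = 0")
  case False
  then have y: "0 < y" using assms by simp
  have "((\<lambda>t. exp ((1 + t * d) * ln y)) has_real_derivative exp ((1 + 0 * d) * ln y) * (d * ln y)) (at 0)"
    by (auto intro!: derivative_eq_intros)
  then have "((\<lambda>t. (exp ((1 + t * d) * ln y) - y) / t) \<longlongrightarrow> y * (d * ln y)) (at 0)"
    using y by (simp add: has_field_derivative_iff)
  moreover have "filterlim (\<lambda>k. 1 / real (k + 2)) (at 0) sequentially"
    unfolding filterlim_at
    by (auto intro!: real_tendsto_divide_at_top filterlim_tendsto_add_at_top[OF tendsto_const filterlim_real_sequentially])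
  ultimately have "(\<lambda>k. (exp ((1 + (1 / real (k + 2)) * d) * ln y) - y) / (1 / real (k + 2))) \<longlonglongrightarrow> y * (d * ln y)"
    by (rule filterlim_compose)
  then show ?thesis using y by (simp add: powr_def mult_ac)
qed simp

text \<open>
  A dominating function for differentiating \<open>\<integral> f powr (1 + t * d)\<close> under the integral sign at \<open>t = 0\<close>.
  By convexity of the exponential, the difference quotient lies between the derivative at 0 and
  the difference quotient over the whole interval \<open>[0, 1]\<close>.
\<close>
lemma abs_powr_difference_quotient_le:
  fixes y d t :: real
  assumes "0 \<le> y" and t: "0 < t" "t < 1"
  shows "\<bar>(y powr (1 + t * d) - y) / t\<bar> \<le> \<bar>d * (y * ln y)\<bar> + (y powr (1 + d) + y)"
proof (cases "y = 0")
  case False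
  then have y: "0 < y" using assms by simp
  define c where "c = d * ln y"
  have e: "y powr (1 + r * d) = y * exp (r * c)" for r
    using y by (simp add: powr_add) (simp add: powr_def c_def mult_ac)
  note e1 = e[of t] and e2 = e[of 1, simplified]
  have "1 powr (1 - t) * exp c powr t \<le> (1 - t) * 1 + t * exp c"
    using t by (intro Youngs_inequality_0) auto
  then have "exp (t * c) \<le> 1 - t + t * exp c" by (simp add: powr_def)
  then have up: "(exp (t * c) - 1) / t \<le> exp c - 1" using t by (simp add: field_simps)
  have "t * c \<le> exp (t * c) - 1" using exp_ge_add_one_self[of "t * c"] by linarith
  then have lo: "c \<le> (exp (t * c) - 1) / t" using t by (simp add: field_simps)
  have "\<bar>(exp (t * c) - 1) / t\<bar> \<le> \<bar>c\<bar> + (exp c + 1)"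
    using up lo exp_gt_zero[of c] by linarith
  then have "y * \<bar>(exp (t * c) - 1) / t\<bar> \<le> y * (\<bar>c\<bar> + (exp c + 1))"
    using y by (intro mult_left_mono) auto
  moreover have "\<bar>(y powr (1 + t * d) - y) / t\<bar> = y * \<bar>(exp (t * c) - 1) / t\<bar>"
  proof -
    have "(y powr (1 + t * d) - y) / t = y * ((exp (t * c) - 1) / t)" unfolding e1 by (simp add: right_diff_distrib diff_divide_distrib)
    then show ?thesis using y by (simp only: abs_mult abs_of_pos)
  qed
  moreover have "\<bar>d * (y * ln y)\<bar> = y * \<bar>c\<bar>" using y by (simp add: c_def abs_mult)
  ultimately show ?thesis by (simp only: e2 distrib_left mult_1_right)
qed simp

text \<open>
  The concave function \<open>G \<alpha> = n ln \<alpha> + ln (\<integral> f\<^sup>\<alpha>)\<close> lies below its tangent at 1, where \<open>G 1 = 0\<close> and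
  \<open>G' 1 = n + \<integral> f ln f\<close>.  Concavity gives \<open>t * G \<alpha> \<le> G (1 + t (\<alpha> - 1))\<close> for \<open>0 < t < 1\<close>; the right-hand side is
  bounded by \<open>ln z \<le> z - 1\<close>, which is sharp to first order, divided by \<open>t\<close>, and \<open>t\<close> tends to 0.
\<close>
lemma integral_powr_le_tangent:
  fixes f :: "'v::euclidean_space \<Rightarrow> real"
  assumes lc: "log_concave_fun f" and m [measurable]: "f \<in> borel_measurable borel"
    and one: "(\<integral>\<^sup>+x. ennreal (f x) \<partial>lborel) = 1" and \<alpha>: "0 < \<alpha>"
  shows "(\<integral>x. f x powr \<alpha> \<partial>lborel) \<le>
    (1 / \<alpha>) ^ DIM('v) * exp ((\<alpha> - 1) * (DIM('v) + (\<integral>x. f x * ln (f x) \<partial>lborel)))"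
proof -
  note nn = log_concave_fun_nonneg[OF lc]
  note int = integrable_powr[OF lc m one]
  define d where "d = \<alpha> - 1"
  define n where "n = real DIM('v)"
  define mm where "mm p = (\<integral>x. f x powr p \<partial>lborel)" for p
  have mm: "(\<integral>\<^sup>+x. ennreal (f x powr p) \<partial>lborel) = ennreal (mm p)" if "0 < p" for p
    unfolding mm_def using int[OF that] by (intro nn_integral_eq_integral) auto
  have mmpos: "0 < mm p" if "0 < p" for p
    using nn_integral_powr_pos[OF m nn one, of p] mm[OF that] by simp
  have mm1: "mm 1 = 1"
    using one mm[of 1] mmpos[of 1] nn by simp
  define t where "t k = 1 / real (k + 2)" for k :: nat
  have t: "0 < t k" "t k < 1" for k by (auto simp: t_def)
  have step: "n * ln \<alpha> + ln (mm \<alpha>) \<le> n * d + (\<integral>x. (f x powr (1 + t k * d) - f x) / t k \<partial>lborel)" for k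
  proof -
    define g where "g = 1 + t k * d"
    have g: "g = (1 - t k) * 1 + t k * \<alpha>" by (simp add: g_def d_def algebra_simps)
    have g0: "0 < g" unfolding g using t[of k] \<alpha> by (intro add_pos_pos) auto
    let ?K = "((1 / g) powr (1 - t k) * (\<alpha> / g) powr t k) ^ DIM('v)"
    have "geometric_mean_le ?K (t k) (ennreal (mm 1)) (ennreal (mm \<alpha>)) (ennreal (mm g))"
      using nn_integral_powr_log_concave[OF lc m _ \<alpha> t g] by (simp add: mm[symmetric] \<alpha> g0)
    then have "?K * mm 1 powr (1 - t k) * mm \<alpha> powr t k \<le> mm g"
      using mmpos g0 \<alpha> by (intro geometric_mean_le_ennrealD) (auto intro: less_imp_le)
    then have "ln (?K * mm \<alpha> powr t k) \<le> ln (mm g)"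
      using g0 \<alpha> mmpos[OF \<alpha>] mmpos[OF g0] by (simp add: mm1)
    also have "ln (?K * mm \<alpha> powr t k) = n * ((1 - t k) * ln (1 / g) + t k * ln (\<alpha> / g)) + t k * ln (mm \<alpha>)"
      using g0 \<alpha> mmpos[OF \<alpha>] by (simp add: ln_mult ln_realpow ln_powr n_def)
    also have "\<dots> = t k * (n * ln \<alpha> + ln (mm \<alpha>)) - n * ln g"
      using g0 \<alpha> by (simp add: ln_div algebra_simps)
    finally have "t k * (n * ln \<alpha> + ln (mm \<alpha>)) \<le> n * ln g + ln (mm g)" by simp
    also have "\<dots> \<le> n * (g - 1) + (mm g - 1)"
      using g0 mmpos[OF g0] by (intro add_mono mult_left_mono ln_le_minus_one) (auto simp: n_def)
    finally have "n * ln \<alpha> + ln (mm \<alpha>) \<le> n * d + (mm g - 1) / t k"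
      using t[of k] by (simp add: field_simps g_def)
    also have "(mm g - 1) / t k = (\<integral>x. (f x powr g - f x) / t k \<partial>lborel)"
    proof -
      have "mm g - 1 = (\<integral>x. f x powr g - f x \<partial>lborel)"
        using int[OF g0] int[of 1] mm1 nn by (simp add: mm_def)
      then show ?thesis by simp
    qed
    finally show ?thesis by (simp add: g_def)
  qed
  have "(\<lambda>k. \<integral>x. (f x powr (1 + t k * d) - f x) / t k \<partial>lborel) \<longlonglongrightarrow> (\<integral>x. d * (f x * ln (f x)) \<partial>lborel)"
  proof (rule integral_dominated_convergence)
    show "integrable lborel (\<lambda>x. \<bar>d * (f x * ln (f x))\<bar> + (f x powr (1 + d) + f x))"
      using integrable_mult_ln[OF lc m one] int[OF \<alpha>] int[of 1] nn by (auto simp: d_def)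
    show "AE x in lborel. (\<lambda>k. (f x powr (1 + t k * d) - f x) / t k) \<longlonglongrightarrow> d * (f x * ln (f x))"
      unfolding t_def using powr_difference_quotient_tendsto[OF nn] by (intro AE_I2)
    show "AE x in lborel. norm ((f x powr (1 + t k * d) - f x) / t k)
        \<le> \<bar>d * (f x * ln (f x))\<bar> + (f x powr (1 + d) + f x)" for k
      unfolding real_norm_def using abs_powr_difference_quotient_le[OF nn t] by (intro AE_I2)
  qed measurable
  then have "(\<lambda>k. n * d + (\<integral>x. (f x powr (1 + t k * d) - f x) / t k \<partial>lborel))
      \<longlonglongrightarrow> n * d + d * (\<integral>x. f x * ln (f x) \<partial>lborel)"
    by (intro tendsto_add) auto
  then have "n * ln \<alpha> + ln (mm \<alpha>) \<le> n * d + d * (\<integral>x. f x * ln (f x) \<partial>lborel)"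
    by (rule LIMSEQ_le_const) (use step in auto)
  then have "ln (mm \<alpha>) \<le> d * (n + (\<integral>x. f x * ln (f x) \<partial>lborel)) - n * ln \<alpha>"
    by (simp add: algebra_simps)
  then have "exp (ln (mm \<alpha>)) \<le> exp (d * (n + (\<integral>x. f x * ln (f x) \<partial>lborel)) - n * ln \<alpha>)"
    by simp
  also have "\<dots> = (1 / \<alpha>) ^ DIM('v) * exp (d * (n + (\<integral>x. f x * ln (f x) \<partial>lborel)))"
    using \<alpha> by (simp add: exp_diff n_def exp_of_nat_mult power_one_over divide_simps)
  finally show ?thesis
    using mmpos[OF \<alpha>] by (simp add: mm_def d_def n_def)
qed

section \<open>The product exponential density\<close>

lemma Basis_vec_real: "(Basis :: (real ^ 'n) set) = range (\<lambda>i. axis i 1)"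
  by (auto simp: Basis_vec_def)

lemma inj_axis_1: "inj (\<lambda>i. axis i (1::real))"
  by (auto simp: inj_on_def axis_eq_axis)

definition exp_density :: "real \<Rightarrow> real" where
  "exp_density s = (if 0 \<le> s then exp (- s) else 0)"

lemma exp_density_nonneg: "0 \<le> exp_density s" by (simp add: exp_density_def)

lemma measurable_exp_density [measurable]: "exp_density \<in> borel_measurable borel"
  unfolding exp_density_def by measurable

lemma quadrant_exp_density_eq_prod:
  "quadrant_exp_density x = (\<Prod>b\<in>Basis. exp_density (x \<bullet> b))"
proof -
  have "(\<Prod>b\<in>Basis. exp_density (x \<bullet> b)) = (\<Prod>i\<in>UNIV. exp_density (x $ i))"
    unfolding Basis_vec_real by (subst prod.reindex[OF inj_axis_1]) (simp add: inner_axis)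
  also have "\<dots> = quadrant_exp_density x"
    by (auto simp: quadrant_exp_density_def exp_density_def exp_sum sum_negf[symmetric])
  finally show ?thesis ..
qed

lemma quadrant_exp_density_nonneg: "0 \<le> quadrant_exp_density x"
  by (simp add: quadrant_exp_density_def)

lemma nn_integral_exp_density_powr:
  assumes "0 < \<alpha>"
  shows "(\<integral>\<^sup>+s. ennreal (exp_density s powr \<alpha>) \<partial>lborel) = ennreal (1 / \<alpha>)"
proof -
  interpret prob_space "density lborel (exponential_density \<alpha>)"
    by (rule prob_space_exponential_density[OF assms])
  have "(\<integral>\<^sup>+s. ennreal (exponential_density \<alpha> s) \<partial>lborel) = 1"
    using emeasure_space_1 by (simp add: emeasure_density)
  moreover have "ennreal (exp_density s powr \<alpha>) = ennreal (1 / \<alpha>) * ennreal (exponential_density \<alpha> s)" for s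
    using assms by (auto simp: exp_density_def exponential_density_def ennreal_mult[symmetric] powr_def mult_ac)
  ultimately show ?thesis by (simp add: nn_integral_cmult)
qed

lemma nn_integral_quadrant_exp_density_powr:
  assumes "0 < \<alpha>"
  shows "(\<integral>\<^sup>+x. ennreal (quadrant_exp_density (x :: real ^ 'n) powr \<alpha>) \<partial>lborel) = ennreal ((1 / \<alpha>) ^ CARD('n))"
proof -
  have "ennreal (quadrant_exp_density x powr \<alpha>) = (\<Prod>b\<in>Basis. ennreal (exp_density (x \<bullet> b) powr \<alpha>))" for x :: "real ^ 'n"
    by (simp add: quadrant_exp_density_eq_prod prod_powr_distrib exp_density_nonneg prod_ennreal)
  then have "(\<integral>\<^sup>+x. ennreal (quadrant_exp_density (x :: real ^ 'n) powr \<alpha>) \<partial>lborel)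
      = (\<Prod>b\<in>(Basis :: (real ^ 'n) set). ennreal (1 / \<alpha>))"
    using nn_integral_exp_density_powr[OF assms]
    by (simp only:) (subst nn_integral_lborel_prod[where f = "\<lambda>_ s. ennreal (exp_density s powr \<alpha>)"], auto)
  then show ?thesis using assms by (simp add: ennreal_power)
qed

lemma nn_integral_id_exp_density:
  "(\<integral>\<^sup>+s. ennreal (s * exp_density s) \<partial>lborel) = 1"
proof -
  have "(\<integral>\<^sup>+s. ennreal (s * exp_density s) \<partial>lborel)
      = (\<integral>\<^sup>+s. ennreal (s ^ 1 * exp (- s)) * indicator {0..} s \<partial>lborel)"
    by (intro nn_integral_cong) (auto simp: exp_density_def indicator_def)
  then show ?thesis unfolding nn_intergal_power_times_exp_Ici by simp
qed

text \<open>
  The factor \<open>x \<bullet> b\<close> only changes one of the factors of the product density, so the integral is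
  the mean of a standard exponential variable.
\<close>
lemma nn_integral_component_quadrant_exp_density:
  fixes b :: "real ^ 'n"
  assumes b: "b \<in> Basis"
  shows "(\<integral>\<^sup>+x. ennreal ((x \<bullet> b) * quadrant_exp_density x) \<partial>lborel) = 1"
proof -
  have one: "(\<integral>\<^sup>+s. ennreal (exp_density s) \<partial>lborel) = 1"
    using nn_integral_exp_density_powr[of 1] by (simp add: exp_density_nonneg)
  let ?g = "\<lambda>c s. ennreal ((if c = b then s else 1) * exp_density s)"
  have "ennreal ((x \<bullet> b) * quadrant_exp_density x) = (\<Prod>c\<in>Basis. ?g c (x \<bullet> c))" for x :: "real ^ 'n"
  proof (cases "0 \<le> x \<bullet> b")
    case True
    have "(\<Prod>c\<in>Basis. ?g c (x \<bullet> c)) = ennreal (\<Prod>c\<in>Basis. (if c = b then x \<bullet> c else 1) * exp_density (x \<bullet> c))"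
      using True by (intro prod_ennreal) (auto simp: exp_density_nonneg)
    also have "(\<Prod>c\<in>Basis. (if c = b then x \<bullet> c else 1) * exp_density (x \<bullet> c)) = (x \<bullet> b) * quadrant_exp_density x"
      using b by (simp add: prod.distrib quadrant_exp_density_eq_prod)
    finally show ?thesis ..
  next
    case False
    \<comment> \<open>Here the product of the values of \<open>ennreal\<close> is not obviously \<open>ennreal\<close> of the product, but both sides vanish.\<close>
    then have z: "exp_density (x \<bullet> b) = 0" by (simp add: exp_density_def)
    then have "?g b (x \<bullet> b) = 0" by simp
    then have "(\<Prod>c\<in>Basis. ?g c (x \<bullet> c)) = 0" using b by (intro prod_zero) auto
    moreover have "quadrant_exp_density x = 0"
      unfolding quadrant_exp_density_eq_prod using b z by (intro prod_zero) auto
    ultimately show ?thesis by simp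
  qed
  then have "(\<integral>\<^sup>+x. ennreal ((x \<bullet> b) * quadrant_exp_density x) \<partial>lborel)
      = (\<Prod>c\<in>Basis. \<integral>\<^sup>+s. ?g c s \<partial>lborel)"
    by (simp only:) (subst nn_integral_lborel_prod, auto)
  also have "\<dots> = (\<Prod>c\<in>(Basis :: (real ^ 'n) set). 1)"
  proof (rule prod.cong)
    show "(\<integral>\<^sup>+s. ?g c s \<partial>lborel) = 1" for c
      by (cases "c = b") (simp_all add: one nn_integral_id_exp_density)
  qed simp
  finally show ?thesis by simp
qed

text \<open>
  On the quadrant \<open>- ln\<close> of the density is the sum of the coordinates, each of which has mean 1.
\<close>
lemma integral_quadrant_exp_density_ln:
  "(\<integral>x. quadrant_exp_density (x :: real ^ 'n) * ln (quadrant_exp_density x) \<partial>lborel) = - real CARD('n)"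
proof -
  have [measurable]: "quadrant_exp_density \<in> borel_measurable (borel :: (real ^ 'n) measure)"
    unfolding quadrant_exp_density_eq_prod[abs_def] by measurable
  have eq: "- (quadrant_exp_density x * ln (quadrant_exp_density x)) = (\<Sum>b\<in>Basis. (x \<bullet> b) * quadrant_exp_density x)" for x :: "real ^ 'n"
  proof -
    have "(\<Sum>b\<in>Basis. x \<bullet> b) = (\<Sum>i\<in>UNIV. x $ i)"
      unfolding Basis_vec_real by (subst sum.reindex[OF inj_axis_1]) (simp add: inner_axis)
    then show ?thesis by (simp add: sum_distrib_right[symmetric] quadrant_exp_density_def)
  qed
  have nonneg: "0 \<le> (x \<bullet> b) * quadrant_exp_density x" if "b \<in> Basis" for x b :: "real ^ 'n"
    using that by (auto simp: Basis_vec_real quadrant_exp_density_def inner_axis)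
  have "(\<integral>\<^sup>+x. ennreal (- (quadrant_exp_density (x :: real ^ 'n) * ln (quadrant_exp_density x))) \<partial>lborel)
      = (\<integral>\<^sup>+x. (\<Sum>b\<in>Basis. ennreal ((x \<bullet> b) * quadrant_exp_density (x :: real ^ 'n))) \<partial>lborel)"
    using nonneg by (simp add: eq sum_ennreal)
  also have "\<dots> = of_nat CARD('n)"
    by (subst nn_integral_sum) (simp_all add: nn_integral_component_quadrant_exp_density)
  finally have "(\<integral>x. - (quadrant_exp_density (x :: real ^ 'n) * ln (quadrant_exp_density x)) \<partial>lborel) = real CARD('n)"
    using nonneg by (subst integral_eq_nn_integral) (auto simp: eq intro!: sum_nonneg)
  then show ?thesis by simp
qed

section \<open>Comparison of exponential moments\<close>

text \<open>
  Exponential moments of the information content are integrals of powers of the density, because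
  \<open>g * exp (- \<beta> ln g) = g powr (1 - \<beta>)\<close>.
\<close>
lemma nn_integral_exp_info_content:
  fixes g :: "'v::euclidean_space \<Rightarrow> real"
  assumes d: "distributed M lborel Y g" and nn: "\<And>x. 0 \<le> g x"
  shows "(\<integral>\<^sup>+\<omega>. ennreal (exp (\<beta> * (info_content g (Y \<omega>) - h))) \<partial>M)
    = ennreal (exp (- \<beta> * h)) * (\<integral>\<^sup>+x. ennreal (g x powr (1 - \<beta>)) \<partial>lborel)"
proof -
  have [measurable]: "g \<in> borel_measurable borel"
    using distributed_real_measurable[OF _ d] nn by simp
  have pt: "ennreal (g x) * ennreal (exp (\<beta> * (info_content g x - h)))
      = ennreal (exp (- \<beta> * h)) * ennreal (g x powr (1 - \<beta>))" for x
  proof (cases "g x = 0")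
    case False
    then have pos: "0 < g x" using nn[of x] by simp
    have "exp z * exp (\<beta> * (- z - h)) = exp (- \<beta> * h) * exp ((1 - \<beta>) * z)" for z
      by (simp add: exp_add[symmetric] algebra_simps)
    from this[of "ln (g x)"]
    have "g x * exp (\<beta> * (info_content g x - h)) = exp (- \<beta> * h) * g x powr (1 - \<beta>)"
      using pos by (simp add: info_content_def powr_def)
    then show ?thesis using pos by (simp add: ennreal_mult[symmetric])
  qed simp
  have "(\<integral>\<^sup>+\<omega>. ennreal (exp (\<beta> * (info_content g (Y \<omega>) - h))) \<partial>M)
      = (\<integral>\<^sup>+x. ennreal (g x) * ennreal (exp (\<beta> * (info_content g x - h))) \<partial>lborel)"
    by (rule distributed_nn_integral[OF d, symmetric]) (auto simp: info_content_def)
  then show ?thesis by (simp add: pt nn_integral_cmult)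
qed

text \<open>
  With \<open>\<alpha> = 1 - \<beta>\<close>, both exponential moments are \<open>exp (- \<beta> h)\<close> times an integral of the \<open>\<alpha>\<close>-th power.
  For the product exponential density this is exactly \<open>exp (- \<beta> n) * (1 / \<alpha>)\<^sup>n\<close>, and the tangent bound
  gives the same number for \<open>f\<close> after \<open>exp (- \<beta> h)\<close> cancels.
\<close>
theorem theorem4p1:
  fixes M :: "'a measure" and N :: "'b measure"
    and X :: "'a \<Rightarrow> real ^ 'n" and Xs :: "'b \<Rightarrow> real ^ 'n"
    and f :: "real ^ 'n \<Rightarrow> real" and \<beta> :: real
  assumes "prob_space M" and "prob_space N"
    and "log_concave_fun f"
    and "distributed M lborel X f"
    and "distributed N lborel Xs quadrant_exp_density"
    and "\<beta> < 1"
  shows "(\<integral>\<^sup>+\<omega>. ennreal (exp (\<beta> * (info_content f (X \<omega>) - info_entropy M f X))) \<partial>M)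
       \<le> (\<integral>\<^sup>+\<omega>. ennreal (exp (\<beta> * (info_content quadrant_exp_density (Xs \<omega>)
                                   - info_entropy N quadrant_exp_density Xs))) \<partial>N)"
proof -
  note nn = log_concave_fun_nonneg[OF assms(3)]
  interpret prob_space M by fact
  have m: "f \<in> borel_measurable borel"
    using distributed_real_measurable[OF _ assms(4)] nn by simp
  have one: "(\<integral>\<^sup>+x. ennreal (f x) \<partial>lborel) = 1"
    using distributed_nn_integral[OF assms(4), of "\<lambda>_. 1"] by (simp add: emeasure_space_1)
  define \<alpha> where "\<alpha> = 1 - \<beta>"
  have \<alpha>: "0 < \<alpha>" using assms(6) by (simp add: \<alpha>_def)
  let ?h = "info_entropy M f X"
  have h: "?h = - (\<integral>x. f x * ln (f x) \<partial>lborel)"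
    by (rule info_entropy_eq_integral[OF assms(4) nn])
  have hs: "info_entropy N quadrant_exp_density Xs = CARD('n)"
    by (simp add: info_entropy_eq_integral[OF assms(5) quadrant_exp_density_nonneg] integral_quadrant_exp_density_ln)
  have "(\<integral>\<^sup>+x. ennreal (f x powr \<alpha>) \<partial>lborel) = ennreal (\<integral>x. f x powr \<alpha> \<partial>lborel)"
    using integrable_powr[OF assms(3) m one \<alpha>] by (intro nn_integral_eq_integral) auto
  also have "\<dots> \<le> ennreal ((1 / \<alpha>) ^ CARD('n) * exp ((\<alpha> - 1) * (CARD('n) - ?h)))"
    using integral_powr_le_tangent[OF assms(3) m one \<alpha>] by (intro ennreal_leI) (simp add: h)
  finally have "ennreal (exp (- \<beta> * ?h)) * (\<integral>\<^sup>+x. ennreal (f x powr \<alpha>) \<partial>lborel)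
      \<le> ennreal (exp (- \<beta> * ?h)) * ennreal ((1 / \<alpha>) ^ CARD('n) * exp ((\<alpha> - 1) * (CARD('n) - ?h)))"
    by (rule mult_left_mono) simp
  also have "\<dots> = ennreal (exp (- \<beta> * CARD('n))) * ennreal ((1 / \<alpha>) ^ CARD('n))"
    using \<alpha> by (simp add: ennreal_mult[symmetric] exp_add[symmetric] mult.left_commute[of "exp _"] \<alpha>_def algebra_simps)
  finally show ?thesis
    using \<alpha>
    by (simp add: nn_integral_exp_info_content[OF assms(4) nn] hs \<alpha>_def[symmetric]
      nn_integral_exp_info_content[OF assms(5) quadrant_exp_density_nonneg] nn_integral_quadrant_exp_density_powr)
qed

end
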